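(* Let $\nu$ be a probability measure on $\mathcal{H}$ with $m_1(\nu)=\sum_{H\in\mathcal{H}}|H|\,\nu(H)=\infty$. Then for any $v\in(0,+\infty)$ the trace $\mathcal{S}^v$ of the Poisson zoo at level $v$ satisfies $\mathcal{S}^v=\mathbb{Z}^d$ almost surely. In particular, $\mathcal{S}^v$ percolates almost surely for any $v\in(0,+\infty)$.
   Context: $\mathbb{Z}^d$ is viewed as a graph in which nearest neighbour vertices are joined by an edge. $\mathcal{H}$ denotes the set of finite, connected, nonempty subsets of $\mathbb{Z}^d$ that contain the origin; $|H|$ is the cardinality of $H$. A subset of $\mathbb{Z}^d$ percolates if the subgraph it spans has an infinite connected component. Poisson zoo: given a probability measure $\nu$ on $\mathcal{H}$ and $v>0$, let $N^v_{x,H}\sim\mathrm{POI}(v\cdot\nu(H))$, $x\in\mathbb{Z}^d$, $H\in\mathcal{H}$, be independent Poisson random variables. The trace of the Poisson zoo at level $v$ is the random set $\mathcal{S}^v:=\bigcup_{x\in\mathbb{Z}^d}\bigcup_{H\in\mathcal{H}:\,N^v_{x,H}\geq1}(x+H)$. *)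

theory Defs
  imports "HOL-Probability.Probability"
begin

definition nn_edges :: "((int ^ 'd::finite) \<times> (int ^ 'd)) set" where
  "nn_edges = {(x, y). (\<Sum>i\<in>UNIV. \<bar>x $ i - y $ i\<bar>) = 1}"

text \<open>The vertex set of the connected component of \<open>x\<close> in the subgraph spanned by \<open>S\<close>;
  meaningful for \<open>x \<in> S\<close> only.\<close>

definition lattice_component :: "(int ^ 'd::finite) set \<Rightarrow> int ^ 'd \<Rightarrow> (int ^ 'd) set" where
  "lattice_component S x = {y. (x, y) \<in> (Restr nn_edges S)\<^sup>*}"

definition lattice_connected :: "(int ^ 'd::finite) set \<Rightarrow> bool" where
  "lattice_connected S \<longleftrightarrow> (\<forall>x\<in>S. \<forall>y\<in>S. y \<in> lattice_component S x)"

definition percolates :: "(int ^ 'd::finite) set \<Rightarrow> bool" where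
  "percolates S \<longleftrightarrow> (\<exists>x\<in>S. infinite (lattice_component S x))"

definition animals :: "(int ^ 'd::finite) set set" where
  "animals = {H. finite H \<and> H \<noteq> {} \<and> lattice_connected H \<and> 0 \<in> H}"

text \<open>A probability measure on the countable set \<open>animals\<close> is rendered as a \<open>pmf\<close> on sets of
  lattice points whose support is contained in \<open>animals\<close>. The first moment takes values in
  \<open>ennreal\<close>, where every family is summable.\<close>

definition m1 :: "(int ^ 'd::finite) set pmf \<Rightarrow> ennreal" where
  "m1 \<nu> = (\<Sum>\<^sub>\<infinity>H\<in>animals. of_nat (card H) * ennreal (pmf \<nu> H))"

text \<open>The library's \<open>poisson_pmf\<close> is specified for strictly positive rates only, but
  \<open>v * pmf \<nu> H\<close> may vanish.\<close>

definition POI :: "real \<Rightarrow> nat pmf" where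
  "POI r = (if r = 0 then return_pmf 0 else poisson_pmf r)"

lemma pmf_POI: "r \<ge> 0 \<Longrightarrow> pmf (POI r) k = r ^ k / fact k * exp (- r)"
  by (cases "r = 0") (auto simp: POI_def power_0_left)

definition zoo_counts ::
  "'w measure \<Rightarrow> (int ^ 'd::finite) set pmf \<Rightarrow> real \<Rightarrow>
    (int ^ 'd \<Rightarrow> (int ^ 'd) set \<Rightarrow> 'w \<Rightarrow> nat) \<Rightarrow> bool" where
  "zoo_counts M \<nu> v N \<longleftrightarrow>
     prob_space.indep_vars M (\<lambda>_. count_space UNIV) (\<lambda>(x, H). N x H) (UNIV \<times> animals) \<and>
     (\<forall>x. \<forall>H\<in>animals. distr M (count_space UNIV) (N x H) = measure_pmf (POI (v * pmf \<nu> H)))"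

definition zoo_trace ::
  "(int ^ 'd::finite \<Rightarrow> (int ^ 'd) set \<Rightarrow> 'w \<Rightarrow> nat) \<Rightarrow> 'w \<Rightarrow> (int ^ 'd) set" where
  "zoo_trace N \<omega> = (\<Union>x. \<Union>H\<in>{H \<in> animals. N x H \<omega> \<ge> 1}. (+) x ` H)"

end

theory Submission
  imports Defs
begin

text \<open>A point \<open>y\<close> is left uncovered exactly when no pair \<open>(x, H)\<close> with \<open>y \<in> x + H\<close> is present.
  An animal \<open>H\<close> covers \<open>y\<close> from exactly \<open>card H\<close> positions \<open>x = y - h\<close>, \<open>h \<in> H\<close>, so the rates
  \<open>v * \<nu> H\<close> of these pairs add up to \<open>v * m1 \<nu>\<close>, which is infinite. By independence, the probability
  that a finite set of them is absent is the exponential of minus its total rate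
  (\<open>prob_all_counts_zero\<close>); since finite subfamilies have arbitrarily large total rate
  (\<open>finite_covering_family\<close>), \<open>y\<close> is covered almost surely. There are countably many points \<open>y\<close>,
  so almost surely all of them are covered at once. Finally, the full lattice percolates because a
  coordinate axis is an infinite connected set (\<open>percolates_UNIV\<close>).\<close>

text \<open>The index \<open>undefined\<close> picks an arbitrary coordinate direction: along any of them the
  multiples of the unit vector form an infinite path.\<close>

lemma percolates_UNIV: "percolates (UNIV :: (int ^ 'd::finite) set)"
proof -
  define p :: "nat \<Rightarrow> int ^ 'd" where "p k = axis undefined (int k)" for k
  have step: "(p k, p (Suc k)) \<in> nn_edges" for k
  proof -
    have "(\<Sum>i\<in>UNIV. \<bar>p k $ i - p (Suc k) $ i\<bar>) = (\<Sum>i\<in>(UNIV :: 'd set). if i = undefined then 1 else 0)"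
      by (intro sum.cong) (auto simp: p_def axis_def)
    then show ?thesis
      by (simp add: nn_edges_def)
  qed
  have "(p 0, p k) \<in> nn_edges\<^sup>*" for k
    by (induction k) (auto intro: rtrancl_into_rtrancl step)
  then have "range p \<subseteq> lattice_component UNIV (p 0)"
    by (auto simp: lattice_component_def)
  moreover have "inj p"
    by (auto simp: inj_on_def p_def axis_eq_axis)
  then have "infinite (range p)"
    by (rule range_inj_infinite)
  ultimately show ?thesis
    unfolding percolates_def using infinite_super by blast
qed

lemma prob_all_counts_zero:
  fixes \<nu> :: "(int ^ 'd::finite) set pmf"
  assumes "prob_space M" and zoo: "zoo_counts M \<nu> v N" and "v \<ge> 0"
    and "finite J" and J: "J \<subseteq> UNIV \<times> animals"
  defines "E \<equiv> {\<omega>\<in>space M. \<forall>(x, H)\<in>J. N x H \<omega> = 0}"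
  shows "E \<in> sets M"
    and "measure M E = exp (- (v * (\<Sum>(x, H)\<in>J. pmf \<nu> H)))"
proof -
  interpret prob_space M by fact
  define X where "X = (\<lambda>(x, H). N x H)"
  have indep: "indep_vars (\<lambda>_. count_space UNIV) X (UNIV \<times> animals)"
    using zoo by (simp add: zoo_counts_def X_def)
  have rv: "X i \<in> measurable M (count_space UNIV)" if "i \<in> J" for i
    using indep that J by (auto simp: indep_vars_def)
  have E: "E = {\<omega>\<in>space M. \<forall>i\<in>J. X i \<omega> = 0}"
    by (auto simp: E_def X_def)
  show "E \<in> sets M"
    unfolding E using \<open>finite J\<close> rv by measurable
  have zero: "prob (X i -` {0} \<inter> space M) = exp (- (v * pmf \<nu> (snd i)))" if "i \<in> J" for i
  proof -
    obtain x H where i: "i = (x, H)" "H \<in> animals"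
      using \<open>i \<in> J\<close> J by auto
    have "prob (X i -` {0} \<inter> space M) = measure (distr M (count_space UNIV) (X i)) {0}"
      using rv[OF that] by (simp add: measure_distr)
    also have "distr M (count_space UNIV) (X i) = measure_pmf (POI (v * pmf \<nu> H))"
      using zoo i by (simp add: zoo_counts_def X_def)
    finally show ?thesis
      using i \<open>v \<ge> 0\<close> by (simp add: measure_pmf_single pmf_POI)
  qed
  show "measure M E = exp (- (v * (\<Sum>(x, H)\<in>J. pmf \<nu> H)))"
  \<comment> \<open>The product formula for independent events requires a nonempty index set.\<close>
  proof (cases "J = {}")
    case True
    then show ?thesis
      by (simp add: E prob_space)
  next
    case False
    then have "E = (\<Inter>i\<in>J. X i -` {0} \<inter> space M)"
      by (auto simp: E)
    also have "prob \<dots> = (\<Prod>i\<in>J. prob (X i -` {0} \<inter> space M))"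
      using indep_varsD[OF indep False \<open>finite J\<close> J] by simp
    also have "\<dots> = exp (\<Sum>i\<in>J. - (v * pmf \<nu> (snd i)))"
      using \<open>finite J\<close> zero by (simp add: exp_sum)
    finally show ?thesis
      by (simp add: sum_negf sum_distrib_left case_prod_unfold)
  qed
qed

text \<open>This turns the infinite first moment into an infinite rate of covering a fixed point: the
  factor \<open>card H\<close> in \<open>m1\<close> counts the translates of \<open>H\<close> that contain \<open>y\<close>.\<close>

lemma finite_covering_family:
  fixes \<nu> :: "(int ^ 'd::finite) set pmf" and y :: "int ^ 'd" and c :: real
  assumes "m1 \<nu> = \<infinity>"
  obtains J where "finite J" "J \<subseteq> {(x, H). H \<in> animals \<and> y \<in> (+) x ` H}"
    "c < (\<Sum>(x, H)\<in>J. pmf \<nu> H)"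
proof -
  have "ennreal c < m1 \<nu>"
    using assms by simp
  also have "m1 \<nu> = (SUP F\<in>{F. finite F \<and> F \<subseteq> animals}.
      \<Sum>H\<in>F. of_nat (card H) * ennreal (pmf \<nu> H))"
    unfolding m1_def by (rule nonneg_infsum_complete) simp
  finally obtain F where F: "finite F" "F \<subseteq> animals"
    and "ennreal c < (\<Sum>H\<in>F. of_nat (card H) * ennreal (pmf \<nu> H))"
    by (auto simp: less_SUP_iff)
  moreover have "(\<Sum>H\<in>F. of_nat (card H) * ennreal (pmf \<nu> H))
      = ennreal (\<Sum>H\<in>F. real (card H) * pmf \<nu> H)"
    by (simp add: ennreal_mult flip: sum_ennreal ennreal_of_nat_eq_real_of_nat)
  ultimately have c: "c < (\<Sum>H\<in>F. real (card H) * pmf \<nu> H)"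
    by (metis ennreal_leI not_le)
  have fin: "finite H" if "H \<in> F" for H
    using F that by (auto simp: animals_def)
  \<comment> \<open>\<open>g (H, h)\<close> is \<open>H\<close> placed so that its point \<open>h\<close> lands on \<open>y\<close>; distinct pairs give distinct
    placements.\<close>
  define g where "g = (\<lambda>(H :: (int ^ 'd) set, h). (y - h, H))"
  have "(\<Sum>(x, H)\<in>g ` Sigma F (\<lambda>H. H). pmf \<nu> H) = (\<Sum>(H, h)\<in>Sigma F (\<lambda>H. H). pmf \<nu> H)"
    by (subst sum.reindex) (auto simp: inj_on_def g_def case_prod_unfold)
  also have "\<dots> = (\<Sum>H\<in>F. real (card H) * pmf \<nu> H)"
    using F fin by (simp flip: sum.Sigma)
  finally have "c < (\<Sum>(x, H)\<in>g ` Sigma F (\<lambda>H. H). pmf \<nu> H)"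
    using c by simp
  moreover have "finite (g ` Sigma F (\<lambda>H. H))"
    using F fin by simp
  moreover have "g ` Sigma F (\<lambda>H. H) \<subseteq> {(x, H). H \<in> animals \<and> y \<in> (+) x ` H}"
    using F by (force simp: g_def)
  ultimately show ?thesis
    using that by blast
qed

lemma AE_covers_point:
  fixes \<nu> :: "(int ^ 'd::finite) set pmf" and y :: "int ^ 'd"
  assumes "m1 \<nu> = \<infinity>" and "v > 0" and "prob_space M" and zoo: "zoo_counts M \<nu> v N"
  shows "AE \<omega> in M. y \<in> zoo_trace N \<omega>"
proof -
  interpret prob_space M by fact
  have "\<exists>J. finite J \<and> J \<subseteq> {(x, H). H \<in> animals \<and> y \<in> (+) x ` H}
      \<and> real n / v < (\<Sum>(x, H)\<in>J. pmf \<nu> H)" for n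
    by (rule finite_covering_family[OF assms(1)]) blast
  from choice[OF allI, OF this] obtain J
    where *: "\<forall>n. finite (J n) \<and> J n \<subseteq> {(x, H). H \<in> animals \<and> y \<in> (+) x ` H}
      \<and> real n / v < (\<Sum>(x, H)\<in>J n. pmf \<nu> H)" ..
  have fin: "finite (J n)"
    and J: "J n \<subseteq> {(x, H). H \<in> animals \<and> y \<in> (+) x ` H}"
    and big: "real n / v < (\<Sum>(x, H)\<in>J n. pmf \<nu> H)" for n
    using spec[OF *, of n] by simp_all
  \<comment> \<open>An outcome that leaves \<open>y\<close> uncovered lies in every event \<open>E n\<close>, which is measurable with
    probability at most \<open>exp (- n)\<close>; so these outcomes lie in a null set.\<close>
  define E where "E n = {\<omega>\<in>space M. \<forall>(x, H)\<in>J n. N x H \<omega> = 0}" for n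
  have "J n \<subseteq> UNIV \<times> animals" for n
    using J by fast
  note E = prob_all_counts_zero[OF \<open>prob_space M\<close> zoo less_imp_le[OF \<open>v > 0\<close>] fin this,
      folded E_def]
  have "prob (E n) \<le> exp (- real n)" for n
    using big[of n] \<open>v > 0\<close> by (simp add: E(2) field_simps)
  then have "prob (\<Inter>n. E n) \<le> exp (- real n)" for n
    using finite_measure_mono[of "\<Inter>n. E n" "E n"] E(1) by (meson INT_lower UNIV_I order_trans)
  moreover have "(\<lambda>n. exp (- real n)) \<longlonglongrightarrow> 0"
    by real_asymp
  ultimately have "prob (\<Inter>n. E n) \<le> 0"
    by (intro LIMSEQ_le_const) auto
  then have "(\<Inter>n. E n) \<in> null_sets M"
    using E(1) by (auto simp: null_sets_def emeasure_eq_measure measure_le_0_iff)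
  moreover have "{\<omega>\<in>space M. y \<notin> zoo_trace N \<omega>} \<subseteq> (\<Inter>n. E n)"
  proof clarify
    fix \<omega> n
    assume \<omega>: "\<omega> \<in> space M" "y \<notin> zoo_trace N \<omega>"
    have "N x H \<omega> = 0" if "(x, H) \<in> J n" for x H
    proof (rule ccontr)
      assume "N x H \<omega> \<noteq> 0"
      moreover have "H \<in> animals" "y \<in> (+) x ` H"
        using J[of n] that by auto
      ultimately have "y \<in> zoo_trace N \<omega>"
        unfolding zoo_trace_def by (intro UN_I[of x] UN_I[of H]) auto
      with \<omega> show False
        by simp
    qed
    with \<omega> show "\<omega> \<in> E n"
      by (auto simp: E_def)
  qed
  ultimately show ?thesis
    by (rule AE_I')
qed

theorem lemma1p5:
  fixes \<nu> :: "(int ^ 'd::finite) set pmf"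
    and M :: "'w measure"
    and v :: real
    and N :: "int ^ 'd \<Rightarrow> (int ^ 'd) set \<Rightarrow> 'w \<Rightarrow> nat"
  assumes "set_pmf \<nu> \<subseteq> animals"
    and "m1 \<nu> = \<infinity>"
    and "v > 0"
    and "prob_space M"
    and "zoo_counts M \<nu> v N"
  shows "(AE \<omega> in M. zoo_trace N \<omega> = UNIV) \<and> (AE \<omega> in M. percolates (zoo_trace N \<omega>))"
proof -
  have "AE \<omega> in M. \<forall>y. y \<in> zoo_trace N \<omega>"
    by (subst AE_all_countable) (use AE_covers_point[OF assms(2-5)] in blast)
  then have full: "AE \<omega> in M. zoo_trace N \<omega> = UNIV"
    by (rule AE_mp) auto
  then have "AE \<omega> in M. percolates (zoo_trace N \<omega>)"
    by (rule AE_mp) (simp add: percolates_UNIV)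
  with full show ?thesis
    by blast
qed

end
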